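(* Let $N\ge2$ and let $\Omega\subset\mathbb{R}^N$ be a bounded domain with boundary $\Gamma$ satisfying the uniform interior and exterior sphere conditions with radii $r_i$ and $r_e$, and let $u\in C^1(\overline\Omega)\cap C^2(\Omega)$ be a solution of $\Delta u=N$ in $\Omega$, $u=0$ on $\Gamma$. Then $$r_i\le|\nabla u|\le c_N\,\frac{d_\Omega(d_\Omega+r_e)}{r_e}\quad\text{on }\Gamma,$$ where $d_\Omega$ is the diameter of $\Omega$, $c_N=3/2$ for $N=2$ and $c_N=N/2$ for $N\ge3$.
   Context: Uniform interior (resp. exterior) sphere condition with radius $r_i$ (resp. $r_e$): for every $p\in\Gamma$ there is a ball of radius $r_i$ contained in $\Omega$ (resp. of radius $r_e$ contained in $\mathbb{R}^N\setminus\overline\Omega$) whose closure meets $\Gamma$ only at $p$. *)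

theory Defs
  imports "HOL-Analysis.Analysis"
begin

definition interior_sphere_cond :: "(real^'n) set \<Rightarrow> real \<Rightarrow> bool" where
  "interior_sphere_cond \<Omega> r \<longleftrightarrow> r > 0 \<and>
     (\<forall>p\<in>frontier \<Omega>. \<exists>x. ball x r \<subseteq> \<Omega> \<and> cball x r \<inter> frontier \<Omega> = {p})"

definition exterior_sphere_cond :: "(real^'n) set \<Rightarrow> real \<Rightarrow> bool" where
  "exterior_sphere_cond \<Omega> r \<longleftrightarrow> r > 0 \<and>
     (\<forall>p\<in>frontier \<Omega>. \<exists>x. ball x r \<subseteq> - closure \<Omega> \<and> cball x r \<inter> frontier \<Omega> = {p})"

definition C1_closure_grad :: "(real^'n) set \<Rightarrow> (real^'n \<Rightarrow> real) \<Rightarrow> (real^'n \<Rightarrow> real^'n) \<Rightarrow> bool" where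
  "C1_closure_grad \<Omega> u Du \<longleftrightarrow> continuous_on (closure \<Omega>) u \<and> continuous_on (closure \<Omega>) Du \<and>
     (\<forall>x\<in>\<Omega>. (u has_derivative (\<lambda>h. Du x \<bullet> h)) (at x))"

text \<open>u in C^2(Omega), expressed via its gradient Du: Du is differentiable in Omega and all second
  partial derivatives are continuous in Omega.\<close>
definition C2_grad :: "(real^'n) set \<Rightarrow> (real^'n \<Rightarrow> real^'n) \<Rightarrow> bool" where
  "C2_grad \<Omega> Du \<longleftrightarrow> (\<forall>x\<in>\<Omega>. Du differentiable (at x)) \<and>
     (\<forall>i j. continuous_on \<Omega> (\<lambda>x. frechet_derivative Du (at x) (axis j 1) $ i))"

definition laplacian_grad :: "(real^'n \<Rightarrow> real^'n) \<Rightarrow> real^'n \<Rightarrow> real" where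
  "laplacian_grad Du x = (\<Sum>i\<in>UNIV. frechet_derivative Du (at x) (axis i 1) $ i)"

end

theory Submission
  imports Defs
begin

text \<open>
  Both bounds come from comparing \<open>u\<close>, which is nonpositive by the maximum principle, with explicit
  functions that touch it at a boundary point \<open>p\<close>. Since \<open>u \<le> 0\<close> on the interior ball at \<open>p\<close>, whose
  centre is \<open>x\<^sub>0\<close>, the gradient at \<open>p\<close> is a nonnegative multiple of \<open>p - x\<^sub>0\<close>, so only its
  component along \<open>x\<^sub>0 - p\<close> matters. The lower bound follows from
  \<open>u \<le> (\<bar>x - x\<^sub>0\<bar>\<^sup>2 - r\<^sub>i\<^sup>2) / 2\<close> on the interior ball.

  For the upper bound, the solution of \<open>\<Delta>w = N\<close> in the annulus
  \<open>r\<^sub>e < \<bar>x - y\<bar> < r\<^sub>e + d\<close> around the exterior ball, centred at \<open>y\<close>, is not good enough: for \<open>N \<ge> 8\<close> and small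
  \<open>d / r\<^sub>e\<close> its slope exceeds the claimed bound. Using also that \<open>\<Omega>\<close> lies in the ball of
  radius \<open>d\<close> about \<open>p\<close>, one takes, with \<open>m = N - 2\<close> and \<open>r = \<bar>x - y\<bar>\<close>, the subsolution
  \<open>w = (\<bar>x - p\<bar>\<^sup>2 - d\<^sup>2) / 2 * (1 - (r\<^sub>e / r) ^ m) + \<psi>(r)\<close>. The product of the torsion
  function of that ball with a harmonic function misses \<open>\<Delta>w \<ge> N\<close> only by a term of order
  \<open>(r\<^sub>e / r) ^ m\<close>, which the radial correction \<open>\<psi>\<close> makes up for. For \<open>N = 2\<close> only \<open>\<psi>\<close> remains.
\<close>

subsection \<open>Maximum principle and boundary gradients\<close>

lemma C1_closure_grad_diff:
  assumes "C1_closure_grad \<Omega> u Du" "C1_closure_grad \<Omega> v Dv"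
  shows "C1_closure_grad \<Omega> (\<lambda>x. u x - v x) (\<lambda>x. Du x - Dv x)"
  using assms unfolding C1_closure_grad_def
  by (auto intro!: continuous_intros derivative_eq_intros simp: inner_diff_left)

lemma has_real_derivative_along_line:
  fixes v :: "'a::real_inner \<Rightarrow> real"
  assumes "(v has_derivative (\<lambda>k. g \<bullet> k)) (at (p + t *\<^sub>R h))"
  shows "((\<lambda>t. v (p + t *\<^sub>R h)) has_real_derivative g \<bullet> h) (at t)"
proof -
  have "((\<lambda>t. p + t *\<^sub>R h) has_derivative (\<lambda>k. k *\<^sub>R h)) (at t)"
    by (auto intro!: derivative_eq_intros)
  from has_derivative_compose[OF this assms] show ?thesis
    by (simp add: has_field_derivative_def mult_commute_abs)
qed

text \<open>On the line through \<open>x\<close> in direction \<open>h\<close> the slope of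
  \<open>v\<close> vanishes at \<open>x\<close>. Were \<open>L h \<bullet> h\<close> positive, the
  slope would be positive just beyond \<open>x\<close> and \<open>v\<close> would exceed its
  maximum.\<close>

lemma second_derivative_nonpos_at_max:
  fixes v :: "real^'n \<Rightarrow> real"
  assumes "open S" "x \<in> S" "\<And>z. z \<in> S \<Longrightarrow> v z \<le> v x"
    and grad: "\<And>z. z \<in> S \<Longrightarrow> (v has_derivative (\<lambda>h. Dv z \<bullet> h)) (at z)"
    and hess: "(Dv has_derivative L) (at x)"
  shows "L h \<bullet> h \<le> 0"
proof (rule ccontr)
  assume "\<not> L h \<bullet> h \<le> 0"
  then have pos: "L h \<bullet> h > 0" by simp
  define g where "g = (\<lambda>t. v (x + t *\<^sub>R h))"
  define g' where "g' = (\<lambda>t. Dv (x + t *\<^sub>R h) \<bullet> h)"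
  have "open ((\<lambda>t. x + t *\<^sub>R h) -` S)"
    by (intro open_vimage \<open>open S\<close> continuous_intros)
  moreover have "0 \<in> (\<lambda>t. x + t *\<^sub>R h) -` S" using \<open>x \<in> S\<close> by simp
  ultimately obtain e where e: "e > 0" "ball 0 e \<subseteq> (\<lambda>t. x + t *\<^sub>R h) -` S"
    using open_contains_ball by blast
  have inS: "x + t *\<^sub>R h \<in> S" if "\<bar>t\<bar> < e" for t
    using e that by (auto simp: subset_iff dist_norm)
  have dg: "(g has_real_derivative g' t) (at t)" if "\<bar>t\<bar> < e" for t
    unfolding g_def g'_def
    by (rule has_real_derivative_along_line[OF grad[OF inS[OF that]]])
  have "g' 0 = 0"
  proof (rule DERIV_local_max[OF dg \<open>e > 0\<close>])
    show "\<bar>0\<bar> < e" using \<open>e > 0\<close> by simp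
    show "\<forall>t. \<bar>0 - t\<bar> < e \<longrightarrow> g t \<le> g 0"
      using assms(3) inS by (simp add: g_def)
  qed
  have "((\<lambda>t. x + t *\<^sub>R h) has_derivative (\<lambda>k. k *\<^sub>R h)) (at 0)"
    by (auto intro!: derivative_eq_intros)
  from has_derivative_compose[OF this, of Dv L] hess
  have "((\<lambda>t. Dv (x + t *\<^sub>R h)) has_derivative (\<lambda>k. L (k *\<^sub>R h))) (at 0)"
    by simp
  then have "(g' has_derivative (\<lambda>k. L (k *\<^sub>R h) \<bullet> h)) (at 0)"
    unfolding g'_def by (rule has_derivative_inner_left)
  then have "(g' has_real_derivative L h \<bullet> h) (at 0)"
    by (simp add: has_field_derivative_def linear_cmul[OF has_derivative_linear[OF hess]]
        mult_commute_abs)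
  from DERIV_pos_inc_right[OF this pos] obtain d where d: "d > 0"
    "\<And>k. 0 < k \<Longrightarrow> k < d \<Longrightarrow> g' 0 < g' k" by auto
  define t where "t = min d e / 2"
  have t: "0 < t" "t < d" "t < e" using d(1) e(1) by (auto simp: t_def)
  have "g 0 < g t"
  proof (rule DERIV_pos_imp_increasing_open[OF t(1)])
    fix k assume "0 < k" "k < t"
    then show "\<exists>y. (g has_real_derivative y) (at k) \<and> 0 < y"
      using dg[of k] d(2)[of k] t \<open>g' 0 = 0\<close> by force
  next
    show "continuous_on {0..t} g"
      using t by (intro continuous_at_imp_continuous_on ballI DERIV_isCont[OF dg]) auto
  qed
  moreover have "g t \<le> g 0" using assms(3) inS[of t] t by (simp add: g_def)
  ultimately show False by simp
qed

text \<open>Adding a small multiple of \<open>z \<bullet> z\<close> makes the Laplacian strictly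
  positive, which is impossible at an interior maximum, where all pure second derivatives are
  nonpositive.\<close>

lemma weak_maximum_principle:
  fixes v :: "real^'n \<Rightarrow> real"
  assumes "open \<Omega>" "bounded \<Omega>" and cont: "continuous_on (closure \<Omega>) v"
    and grad: "\<And>x. x \<in> \<Omega> \<Longrightarrow> (v has_derivative (\<lambda>h. Dv x \<bullet> h)) (at x)"
    and lap: "\<And>x. x \<in> \<Omega> \<Longrightarrow>
      \<exists>L. (Dv has_derivative L) (at x) \<and> (\<Sum>i\<in>UNIV. L (axis i 1) $ i) \<ge> 0"
    and bdry: "\<And>x. x \<in> frontier \<Omega> \<Longrightarrow> v x \<le> 0"
    and "x \<in> closure \<Omega>"
  shows "v x \<le> 0"
proof (rule ccontr)
  assume "\<not> v x \<le> 0"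
  then have vx: "v x > 0" by simp
  have comp: "compact (closure \<Omega>)" using \<open>bounded \<Omega>\<close> by (simp add: compact_closure)
  obtain B where B: "B > 0" "\<And>z. z \<in> closure \<Omega> \<Longrightarrow> norm z \<le> B"
    using bounded_closure[OF \<open>bounded \<Omega>\<close>] unfolding bounded_pos by blast
  \<comment> \<open>With this \<open>\<epsilon>\<close> the added term is at most
    \<open>v x / 2\<close> on \<open>closure \<Omega>\<close>, so a maximum point \<open>z\<close>
    of \<open>w\<close> has \<open>v z \<ge> v x / 2 > 0\<close> and cannot lie on the
    frontier.\<close>
  define \<epsilon> where "\<epsilon> = v x / (2 * B\<^sup>2)"
  have eps: "\<epsilon> > 0" using vx B by (simp add: \<epsilon>_def)
  define w where "w = (\<lambda>z. v z + \<epsilon> * (z \<bullet> z))"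
  define Dw where "Dw = (\<lambda>z. Dv z + (2 * \<epsilon>) *\<^sub>R z)"
  have "continuous_on (closure \<Omega>) w"
    unfolding w_def by (intro continuous_intros cont)
  moreover have "closure \<Omega> \<noteq> {}" using \<open>x \<in> closure \<Omega>\<close> by force
  ultimately have "\<exists>z\<in>closure \<Omega>. \<forall>a\<in>closure \<Omega>. w a \<le> w z"
    by (intro continuous_attains_sup[OF comp])
  then obtain z where z: "z \<in> closure \<Omega>" "\<And>a. a \<in> closure \<Omega> \<Longrightarrow> w a \<le> w z"
    by blast
  have zz: "\<epsilon> * (z \<bullet> z) \<le> v x / 2"
  proof -
    have "z \<bullet> z \<le> B\<^sup>2" using B(2)[OF z(1)] by (simp add: dot_square_norm power_mono)
    then have "\<epsilon> * (z \<bullet> z) \<le> \<epsilon> * B\<^sup>2" using eps by (simp add: mult_left_mono)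
    also have "\<dots> = v x / 2" using B by (simp add: \<epsilon>_def)
    finally show ?thesis .
  qed
  have "v x \<le> w x" using eps by (simp add: w_def)
  also have "\<dots> \<le> w z" using z \<open>x \<in> closure \<Omega>\<close> by blast
  finally have "v z > 0" using zz vx by (simp add: w_def)
  then have "z \<in> \<Omega>" using bdry[of z] z(1) \<open>open \<Omega>\<close> by (auto simp: frontier_def interior_open not_less[symmetric])
  from lap[OF this] obtain L where L: "(Dv has_derivative L) (at z)"
    "(\<Sum>i\<in>UNIV. L (axis i 1) $ i) \<ge> 0" by blast
  have Dw: "(Dw has_derivative (\<lambda>h. L h + (2 * \<epsilon>) *\<^sub>R h)) (at z)"
    unfolding Dw_def by (auto intro!: derivative_eq_intros L(1))
  have *: "(L h + (2 * \<epsilon>) *\<^sub>R h) \<bullet> h \<le> 0" for h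
  proof (rule second_derivative_nonpos_at_max[OF \<open>open \<Omega>\<close> \<open>z \<in> \<Omega>\<close> _ _ Dw])
    fix a assume a: "a \<in> \<Omega>"
    then show "w a \<le> w z" using z(2) closure_subset by blast
    show "(w has_derivative (\<lambda>h. Dw a \<bullet> h)) (at a)"
      unfolding w_def Dw_def
      by (auto intro!: derivative_eq_intros grad[OF a] simp: inner_add_left algebra_simps inner_commute)
  qed
  have "L (axis i 1) $ i < 0" for i
    using *[of "axis i 1"] eps by (simp add: inner_axis)
  then have "(\<Sum>i\<in>UNIV. L (axis i 1) $ i) < 0" 
    using sum_strict_mono[of UNIV "\<lambda>i. L (axis i 1) $ i" "\<lambda>_. 0"] by simp
  with L(2) show False by simp
qed

lemma C1_closure_grad_subset:
  assumes "C1_closure_grad \<Omega> u Du" "S \<subseteq> \<Omega>"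
  shows "C1_closure_grad S u Du"
  using assms closure_mono[OF assms(2)] unfolding C1_closure_grad_def
  by (blast intro: continuous_on_subset)

lemma comparison_principle:
  fixes v w :: "real^'n \<Rightarrow> real"
  assumes "open \<Omega>" "bounded \<Omega>" "C1_closure_grad \<Omega> v Dv" "C1_closure_grad \<Omega> w Dw"
    and lap_v: "\<And>x. x \<in> \<Omega> \<Longrightarrow>
      \<exists>L. (Dv has_derivative L) (at x) \<and> (\<Sum>i\<in>UNIV. L (axis i 1) $ i) \<ge> k"
    and lap_w: "\<And>x. x \<in> \<Omega> \<Longrightarrow>
      \<exists>L. (Dw has_derivative L) (at x) \<and> (\<Sum>i\<in>UNIV. L (axis i 1) $ i) \<le> k"
    and bdry: "\<And>x. x \<in> frontier \<Omega> \<Longrightarrow> v x \<le> w x" and "x \<in> closure \<Omega>"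
  shows "v x \<le> w x"
proof -
  have C1: "C1_closure_grad \<Omega> (\<lambda>x. v x - w x) (\<lambda>x. Dv x - Dw x)"
    using assms by (intro C1_closure_grad_diff)
  have "v x - w x \<le> 0"
  proof (rule weak_maximum_principle[OF assms(1,2), of "\<lambda>x. v x - w x" "\<lambda>x. Dv x - Dw x"])
    fix z assume z: "z \<in> \<Omega>"
    obtain L M where "(Dv has_derivative L) (at z)" "(\<Sum>i\<in>UNIV. L (axis i 1) $ i) \<ge> k"
      "(Dw has_derivative M) (at z)" "(\<Sum>i\<in>UNIV. M (axis i 1) $ i) \<le> k"
      using lap_v[OF z] lap_w[OF z] by blast
    then show "\<exists>L. ((\<lambda>x. Dv x - Dw x) has_derivative L) (at z) \<and> (\<Sum>i\<in>UNIV. L (axis i 1) $ i) \<ge> 0"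
      by (intro exI[of _ "\<lambda>h. L h - M h"]) (auto intro: has_derivative_diff simp: sum_subtractf)
  next
    fix z assume "z \<in> frontier \<Omega>"
    then show "v z - w z \<le> 0" using bdry by simp
  qed (use C1 assms in \<open>auto simp: C1_closure_grad_def\<close>)
  then show ?thesis by simp
qed

text \<open>At a boundary point \<open>Dv p\<close> is only a limit of gradients from inside. If its
  slope along \<open>h\<close> were positive, continuity up to the closure would keep the slope
  positive on the start of the ray, and \<open>v\<close> would rise above
  \<open>v p = 0\<close>.\<close>

lemma inner_le_zero_of_nonpos_along_ray:
  fixes v :: "real^'n \<Rightarrow> real"
  assumes C1: "C1_closure_grad \<Omega> v Dv" and p: "p \<in> closure \<Omega>" "v p = 0" and "\<delta> > 0"
    and ray: "\<And>t. 0 < t \<Longrightarrow> t < \<delta> \<Longrightarrow> p + t *\<^sub>R h \<in> \<Omega> \<and> v (p + t *\<^sub>R h) \<le> 0"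
  shows "Dv p \<bullet> h \<le> 0"
proof (rule ccontr)
  assume "\<not> Dv p \<bullet> h \<le> 0"
  then have pos: "Dv p \<bullet> h > 0" by simp
  have cl: "p + t *\<^sub>R h \<in> closure \<Omega>" if "0 \<le> t" "t < \<delta>" for t
    using that p ray[of t] closure_subset by (cases "t = 0") auto
  have path: "continuous_on {0..<\<delta>} (\<lambda>t. p + t *\<^sub>R h)" "(\<lambda>t. p + t *\<^sub>R h) ` {0..<\<delta>} \<subseteq> closure \<Omega>"
    using cl by (auto intro!: continuous_intros)
  have "continuous_on {0..<\<delta>} (\<lambda>t. Dv (p + t *\<^sub>R h) \<bullet> h)"
    using C1 path unfolding C1_closure_grad_def
    by (intro continuous_on_inner continuous_on_const continuous_on_compose2[OF _ path, of Dv]) auto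
  then have "((\<lambda>t. Dv (p + t *\<^sub>R h) \<bullet> h) \<longlongrightarrow> Dv p \<bullet> h) (at 0 within {0..<\<delta>})"
    using \<open>\<delta> > 0\<close> by (auto simp: continuous_on_def dest!: bspec[where x=0])
  from order_tendstoD(1)[OF this pos] obtain e where e: "e > 0"
    "\<And>t. 0 < t \<Longrightarrow> t < \<delta> \<Longrightarrow> t < e \<Longrightarrow> Dv (p + t *\<^sub>R h) \<bullet> h > 0"
    unfolding eventually_at by (auto simp: dist_real_def)
  define s where "s = min e \<delta> / 2"
  have s: "0 < s" "s < e" "s < \<delta>" using e(1) \<open>\<delta> > 0\<close> by (auto simp: s_def)
  have "v (p + 0 *\<^sub>R h) < v (p + s *\<^sub>R h)"
  proof (rule DERIV_pos_imp_increasing_open[OF s(1)])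
    fix t assume t: "0 < t" "t < s"
    then have "(v has_derivative (\<lambda>k. Dv (p + t *\<^sub>R h) \<bullet> k)) (at (p + t *\<^sub>R h))"
      using C1 ray[of t] s by (auto simp: C1_closure_grad_def)
    from has_real_derivative_along_line[OF this]
    show "\<exists>y. ((\<lambda>t. v (p + t *\<^sub>R h)) has_real_derivative y) (at t) \<and> 0 < y"
      using e(2)[of t] t s by force
  next
    have "continuous_on {0..<\<delta>} (\<lambda>t. v (p + t *\<^sub>R h))"
      using C1 path unfolding C1_closure_grad_def
      by (intro continuous_on_compose2[OF _ path, of v]) auto
    then show "continuous_on {0..s} (\<lambda>t. v (p + t *\<^sub>R h))"
      by (rule continuous_on_subset) (use s in auto)
  qed
  with ray[of s] s p show False by auto
qed

text \<open>For nonzero \<open>e\<close>, the polar of the open half-space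
  \<open>h \<bullet> e > 0\<close> is the ray spanned by \<open>- e\<close>. That \<open>D\<close>
  lies on this ray is expressed as the equality case of Cauchy-Schwarz.\<close>

lemma norm_mult_le_neg_inner_if_dual_cone:
  fixes D e :: "'a::real_inner"
  assumes cone: "\<And>h. h \<bullet> e > 0 \<Longrightarrow> D \<bullet> h \<le> 0"
  shows "norm D * norm e \<le> - (D \<bullet> e)"
proof (cases "e = 0")
  case False
  then have ee: "e \<bullet> e > 0" by simp
  \<comment> \<open>The part of \<open>D\<close> orthogonal to \<open>e\<close> lies on the edge of
    the half-space; adding a small multiple \<open>k\<close> of \<open>e\<close> moves it inside, at
    a cost of at most \<open>\<epsilon>\<close>.\<close>
  define h where "h = D - ((D \<bullet> e) / (e \<bullet> e)) *\<^sub>R e"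
  have he: "h \<bullet> e = 0" using ee by (simp add: h_def inner_diff_left)
  have De: "D \<bullet> e \<le> 0" using cone[OF ee] .
  have "D \<bullet> h \<le> 0 + \<epsilon>" if "\<epsilon> > 0" for \<epsilon>
  proof -
    define k where "k = \<epsilon> / (1 + \<bar>D \<bullet> e\<bar>)"
    have k: "k > 0" using that by (simp add: k_def add_pos_nonneg)
    have "D \<bullet> (h + k *\<^sub>R e) \<le> 0"
      by (rule cone) (use k ee he in \<open>simp add: inner_add_left\<close>)
    then have "D \<bullet> h \<le> k * \<bar>D \<bullet> e\<bar>" using De by (simp add: inner_add_right)
    also have "\<dots> \<le> k * (1 + \<bar>D \<bullet> e\<bar>)" using k by (simp add: algebra_simps)
    also have "\<dots> = \<epsilon>" unfolding k_def by (simp add: add_nonneg_eq_0_iff)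
    finally show ?thesis by simp
  qed
  then have "D \<bullet> h \<le> 0" by (rule field_le_epsilon)
  then have "(D \<bullet> D) * (e \<bullet> e) \<le> (D \<bullet> e) * (D \<bullet> e)"
    using ee by (simp add: h_def inner_diff_right field_simps)
  then have "(norm D * norm e)\<^sup>2 \<le> (- (D \<bullet> e))\<^sup>2"
    by (simp add: power_mult_distrib power2_eq_square dot_square_norm[symmetric, unfolded power2_eq_square] norm_eq_sqrt_inner mult_ac)
  then show ?thesis by (rule power2_le_imp_le) (use De in simp)
qed simp

lemma interior_ball_inward_ray:
  fixes p x0 h :: "'a::real_inner"
  assumes "dist x0 p = r" "h \<bullet> (x0 - p) > 0"
  obtains \<delta> where "\<delta> > 0" "\<And>t. 0 < t \<Longrightarrow> t < \<delta> \<Longrightarrow> p + t *\<^sub>R h \<in> ball x0 r"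
proof
  have "h \<noteq> 0" using assms(2) by auto
  then have hh: "h \<bullet> h > 0" by simp
  \<comment> \<open>The line through \<open>p\<close> in direction \<open>h\<close> meets the sphere
    about \<open>x0\<close> a second time at this parameter.\<close>
  show "2 * (h \<bullet> (x0 - p)) / (h \<bullet> h) > 0" using assms(2) hh by simp
  fix t assume t: "0 < t" "t < 2 * (h \<bullet> (x0 - p)) / (h \<bullet> h)"
  have "(norm (x0 - (p + t *\<^sub>R h)))\<^sup>2 = (norm (x0 - p))\<^sup>2 + t * (t * (h \<bullet> h) - 2 * (h \<bullet> (x0 - p)))"
    by (simp add: power2_norm_eq_inner inner_diff_left inner_diff_right inner_add_left inner_add_right
        inner_commute algebra_simps)
  also have "\<dots> < (norm (x0 - p))\<^sup>2"
    using t hh by (simp add: mult_pos_neg pos_less_divide_eq)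
  finally have "norm (x0 - (p + t *\<^sub>R h)) < norm (x0 - p)"
    by (rule power2_less_imp_less) simp
  then show "p + t *\<^sub>R h \<in> ball x0 r" using assms(1) by (simp add: dist_norm)
qed

lemma touching_ball_dist_eq:
  fixes \<Omega> :: "(real^'n) set"
  assumes "cball x r \<inter> frontier \<Omega> = {p}" "ball x r \<inter> frontier \<Omega> = {}"
  shows "dist x p = r"
  using assms by force

subsection \<open>The barrier outside the exterior ball\<close>

lemma has_derivative_radial:
  fixes x y :: "'a::real_inner"
  assumes "x \<noteq> y" "(f has_real_derivative f') (at (norm (x - y)))"
  shows "((\<lambda>x. f (norm (x - y))) has_derivative (\<lambda>h. f' / norm (x - y) * ((x - y) \<bullet> h))) (at x)"
proof -
  have "((\<lambda>x. x - y) has_derivative (\<lambda>h. h)) (at x)"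
    by (auto intro!: derivative_eq_intros)
  from has_derivative_compose[OF this has_derivative_norm] assms(1)
  have "((\<lambda>x. norm (x - y)) has_derivative (\<lambda>h. h \<bullet> sgn (x - y))) (at x)"
    by simp
  from has_derivative_compose[OF this, of f "\<lambda>h. f' * h"] assms(2)
  show ?thesis
    by (simp add: has_field_derivative_def sgn_div_norm inner_commute divide_inverse mult.assoc)
qed

text \<open>Supplies \<open>\<psi>\<close> from its derivative alone; a closed form would need
  logarithms for \<open>m = 0, 1, 2\<close> and a case distinction.\<close>

lemma antiderivative_on_pos_reals:
  fixes f :: "real \<Rightarrow> real"
  assumes "\<And>x. x > 0 \<Longrightarrow> isCont f x"
  obtains F where "\<And>x. x > 0 \<Longrightarrow> (F has_real_derivative f x) (at x)" "F a = 0"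
proof -
  obtain F where F: "\<And>x. x > 0 \<Longrightarrow> (F has_real_derivative f x) (at x)"
    using einterval_antiderivative[of 0 \<infinity> f] assms
    by (auto simp: has_real_derivative_iff_has_vector_derivative zero_ereal_def)
  have "((\<lambda>x. F x - F a) has_real_derivative f x) (at x)" if "x > 0" for x
    using F[OF that] by (auto intro!: derivative_eq_intros)
  then show ?thesis using that[of "\<lambda>x. F x - F a"] by simp
qed

text \<open>
  The weight \<open>(\<rho> / r) ^ m / r\<close> is decreasing and \<open>r\<^sup>2 + m \<rho> r - C\<close> changes sign once, from
  negative to positive, so freezing the weight at the sign change \<open>c\<close> can only increase the
  integral. The constant \<open>C\<close> makes the unweighted integral nonpositive.
\<close>

lemma radial_correction_nonpos:
  fixes \<rho> d C :: real and m :: nat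
  assumes "\<rho> > 0" "d \<ge> 0"
    and C: "C = \<rho>\<^sup>2 * (1 + m) + \<rho> * d * (1 + m / 2) + d\<^sup>2 / 3"
    and \<psi>: "\<And>r. r > 0 \<Longrightarrow> (\<psi> has_real_derivative (\<rho> / r) ^ m * (r + m * \<rho> - C / r)) (at r)"
    and "\<psi> \<rho> = 0" "\<rho> \<le> r" "r \<le> \<rho> + d"
  shows "\<psi> r \<le> 0"
proof -
  have "C > 0" unfolding C using assms(1,2) by (intro add_pos_nonneg mult_pos_pos) auto
  \<comment> \<open>The positive root of \<open>c\<^sup>2 + m * \<rho> * c = C\<close>, where the
    derivative of \<open>\<psi>\<close> changes sign.\<close>
  define c where "c = (sqrt ((m * \<rho>)\<^sup>2 + 4 * C) - m * \<rho>) / 2"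
  have "m * \<rho> < sqrt ((m * \<rho>)\<^sup>2 + 4 * C)"
    using \<open>C > 0\<close> by (intro real_less_rsqrt) auto
  then have "c > 0" by (simp add: c_def)
  have "(2 * c + m * \<rho>)\<^sup>2 = (m * \<rho>)\<^sup>2 + 4 * C"
    using \<open>C > 0\<close> by (simp add: c_def field_simps)
  then have cC: "C = c\<^sup>2 + m * \<rho> * c" by (simp add: power2_eq_square algebra_simps)
  define k where "k = (\<rho> / c) ^ m / c"
  have "k \<ge> 0" using \<open>c > 0\<close> \<open>\<rho> > 0\<close> by (simp add: k_def)
  define P where "P = (\<lambda>t. (t ^ 3 - \<rho> ^ 3) / 3 + m * \<rho> * (t\<^sup>2 - \<rho>\<^sup>2) / 2 - C * (t - \<rho>))"
  have dP: "(P has_real_derivative (t\<^sup>2 + m * \<rho> * t - C)) (at t)" for t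
    unfolding P_def by (auto intro!: derivative_eq_intros simp: power2_eq_square)
  have "\<psi> r - k * P r \<le> \<psi> \<rho> - k * P \<rho>"
  proof (rule DERIV_nonpos_imp_nonincreasing[OF \<open>\<rho> \<le> r\<close>])
    fix t assume "\<rho> \<le> t" "t \<le> r"
    then have t: "t > 0" using \<open>\<rho> > 0\<close> by simp
    have eq: "(\<rho> / t) ^ m * (t + m * \<rho> - C / t) - k * (t\<^sup>2 + m * \<rho> * t - C)
        = ((\<rho> / t) ^ m / t - k) * (t - c) * (t + c + m * \<rho>)"
      using t unfolding cC by (simp add: field_simps power2_eq_square)
    have mono: "(\<rho> / b) ^ m / b \<le> (\<rho> / a) ^ m / a" if "0 < a" "a \<le> b" for a b
      using that \<open>\<rho> > 0\<close> by (intro frac_le power_mono divide_left_mono) auto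
    have "((\<rho> / t) ^ m / t - k) * (t - c) \<le> 0"
      using mono[of t c] mono[of c t] t \<open>c > 0\<close> unfolding k_def
      by (cases "t \<le> c") (auto intro: mult_nonneg_nonpos mult_nonpos_nonneg)
    then have "((\<rho> / t) ^ m / t - k) * (t - c) * (t + c + m * \<rho>) \<le> 0"
      using t \<open>c > 0\<close> \<open>\<rho> > 0\<close>
      by (intro mult_nonpos_nonneg[of "_ * _"]) auto
    moreover have "((\<lambda>r. \<psi> r - k * P r) has_real_derivative
        (\<rho> / t) ^ m * (t + m * \<rho> - C / t) - k * (t\<^sup>2 + m * \<rho> * t - C)) (at t)"
      by (intro DERIV_diff DERIV_cmult \<psi> dP t)
    ultimately show "\<exists>y. ((\<lambda>r. \<psi> r - k * P r) has_real_derivative y) (at t) \<and> y \<le> 0"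
      unfolding eq by blast
  qed
  then have "\<psi> r \<le> k * P r" using \<open>\<psi> \<rho> = 0\<close> by (simp add: P_def)
  also have "P r = (r - \<rho>) * ((r\<^sup>2 + r * \<rho> + \<rho>\<^sup>2) / 3 + m * \<rho> * (r + \<rho>) / 2 - C)"
    by (simp add: P_def field_simps power2_eq_square power3_eq_cube)
  also have "k * \<dots> \<le> 0"
  proof -
    \<comment> \<open>The average of \<open>t\<^sup>2 + m * \<rho> * t\<close> over \<open>t\<close>
      from \<open>\<rho>\<close> to \<open>r\<close> increases with \<open>r\<close> and equals
      \<open>C\<close> at \<open>r = \<rho> + d\<close>; this is where \<open>C\<close> comes
      from.\<close>
    define e where "e = r - \<rho>"
    have e: "0 \<le> e" "e \<le> d" "r = \<rho> + e" using assms by (auto simp: e_def)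
    have "(r\<^sup>2 + r * \<rho> + \<rho>\<^sup>2) / 3 + m * \<rho> * (r + \<rho>) / 2
        = \<rho>\<^sup>2 * (1 + m) + \<rho> * e * (1 + m / 2) + e\<^sup>2 / 3"
      by (simp add: e(3) field_simps power2_eq_square)
    also have "\<dots> \<le> C" unfolding C using e \<open>\<rho> > 0\<close>
      by (intro add_mono mult_mono divide_right_mono power_mono) auto
    finally show ?thesis using \<open>k \<ge> 0\<close> e by (intro mult_nonneg_nonpos) auto
  qed
  finally show ?thesis .
qed

text \<open>The gradient of the barrier \<open>w\<close>, sorted by the directions
  \<open>x - p\<close> and \<open>x - y\<close>. Only the derivative of \<open>\<psi>\<close>
  enters, through which \<open>C\<close> appears, so second derivatives are explicit.\<close>

definition barrier_grad :: "real \<Rightarrow> real \<Rightarrow> real \<Rightarrow> nat \<Rightarrow> real^'n \<Rightarrow> real^'n \<Rightarrow> real^'n \<Rightarrow> real^'n" where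
  "barrier_grad \<rho> d C m p y x =
     (1 - (\<rho> / norm (x - y)) ^ m) *\<^sub>R (x - p)
     + ((\<rho> / norm (x - y)) ^ m * ((m * ((norm (x - p))\<^sup>2 - d\<^sup>2) / 2 - C) / (norm (x - y))\<^sup>2
          + 1 + m * \<rho> / norm (x - y))) *\<^sub>R (x - y)"

lemma has_real_derivative_radial_power:
  fixes r \<rho> :: real
  assumes "r > 0"
  shows "((\<lambda>r. (\<rho> / r) ^ m) has_real_derivative - (m * (\<rho> / r) ^ m / r)) (at r)"
proof (cases m)
  case (Suc k)
  have "((\<lambda>r. (\<rho> / r) ^ m) has_real_derivative m * (- \<rho> / r\<^sup>2 * (\<rho> / r) ^ (m - 1))) (at r)"
    using assms by (auto intro!: derivative_eq_intros simp: power2_eq_square)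
  also have "m * (- \<rho> / r\<^sup>2 * (\<rho> / r) ^ (m - 1)) = - (m * (\<rho> / r) ^ m / r)"
    using assms by (simp add: Suc power2_eq_square)
  finally show ?thesis .
qed simp

lemma has_derivative_norm_diff_square:
  fixes x p :: "'a::real_inner"
  shows "((\<lambda>x. (norm (x - p))\<^sup>2) has_derivative (\<lambda>h. 2 * ((x - p) \<bullet> h))) (at x)"
  unfolding dot_square_norm[symmetric]
  by (auto intro!: derivative_eq_intros simp: inner_commute algebra_simps)

lemma barrier_has_gradient:
  fixes x p y :: "real^'n"
  assumes "x \<noteq> y"
    and \<psi>: "\<And>r. r > 0 \<Longrightarrow> (\<psi> has_real_derivative (\<rho> / r) ^ m * (r + m * \<rho> - C / r)) (at r)"
  shows "((\<lambda>x. ((norm (x - p))\<^sup>2 - d\<^sup>2) / 2 * (1 - (\<rho> / norm (x - y)) ^ m) + \<psi> (norm (x - y)))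
     has_derivative (\<lambda>h. barrier_grad \<rho> d C m p y x \<bullet> h)) (at x)"
proof -
  define r where "r = norm (x - y)"
  define E where "E = (\<rho> / r) ^ m"
  have r: "r > 0" using assms(1) by (simp add: r_def)
  note dE = has_derivative_radial[OF assms(1) has_real_derivative_radial_power[OF r[unfolded r_def]],
      of \<rho> m, folded r_def, folded E_def]
  note dF = has_derivative_radial[OF assms(1) \<psi>[OF r[unfolded r_def]], folded r_def, folded E_def]
  have dS: "((\<lambda>x. ((norm (x - p))\<^sup>2 - d\<^sup>2) / 2) has_derivative (\<lambda>h. (x - p) \<bullet> h)) (at x)"
    by (rule has_derivative_eq_rhs, (rule derivative_intros has_derivative_norm_diff_square)+) auto
  note dw = has_derivative_add[OF has_derivative_mult[OF dS
      has_derivative_diff[OF has_derivative_const dE]] dF]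
  show ?thesis
    by (rule has_derivative_eq_rhs[OF dw],
        unfold barrier_grad_def r_def[symmetric] E_def[symmetric] inner_add_left inner_scaleR_left)
      (use r in \<open>simp add: fun_eq_iff field_simps power2_eq_square\<close>)
qed

lemma trace_rank_one:
  fixes a b :: "real^'n"
  shows "(\<Sum>i\<in>UNIV. ((a \<bullet> axis i 1) *\<^sub>R b) $ i) = a \<bullet> b"
  by (simp add: inner_axis) (simp add: inner_vec_def)

text \<open>Write \<open>N = m + 2\<close>. As \<open>E = (\<rho> / r) ^ m\<close> is harmonic, the
  product in \<open>w\<close> contributes \<open>N * (1 - E) + 2 * m * E * q / r\<^sup>2\<close>,
  and \<open>\<psi>\<close> contributes \<open>E * (2 + m * \<rho> / r)\<close>. The surplus over
  \<open>N\<close> is \<open>E * m * (s + \<rho> * (r - \<rho>)) / r\<^sup>2\<close>;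
  \<open>C\<close> and \<open>d\<close> drop out because they multiply harmonic functions.\<close>

lemma barrier_laplacian_ge:
  fixes x p y :: "real^'n"
  assumes "\<rho> > 0" "norm (x - y) \<ge> \<rho>" "norm (p - y) = \<rho>" "CARD('n) = m + 2"
  shows "\<exists>L. (barrier_grad \<rho> d C m p y has_derivative L) (at x)
     \<and> (\<Sum>i\<in>UNIV. L (axis i 1) $ i) \<ge> real CARD('n)"
proof -
  define r where "r = norm (x - y)"
  define E where "E = (\<rho> / r) ^ m"
  define s where "s = (norm (x - p))\<^sup>2"
  have r: "r > 0" "r \<ge> \<rho>" and ne: "x \<noteq> y" using assms by (auto simp: r_def)
  have rr: "norm (x - y) > 0" using r by (simp add: r_def)
  have E0: "E \<ge> 0" using r \<open>\<rho> > 0\<close> by (simp add: E_def)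
  note dE = has_derivative_radial[OF ne has_real_derivative_radial_power[OF rr], of \<rho> m,
      folded r_def, folded E_def]
  have dI: "((\<lambda>x. 1 / norm (x - y)) has_derivative (\<lambda>h. - (1 / r ^ 3) * ((x - y) \<bullet> h))) (at x)"
  proof (rule has_derivative_eq_rhs[OF has_derivative_radial[OF ne]])
    show "((\<lambda>r. 1 / r) has_real_derivative - (1 / r\<^sup>2)) (at (norm (x - y)))"
      using rr by (auto intro!: derivative_eq_intros simp: r_def power2_eq_square)
  qed (use r in \<open>simp add: r_def power2_eq_square power3_eq_cube\<close>)
  have dJ: "((\<lambda>x. 1 / (norm (x - y))\<^sup>2) has_derivative (\<lambda>h. - (2 / r ^ 4) * ((x - y) \<bullet> h))) (at x)"
  proof (rule has_derivative_eq_rhs[OF has_derivative_radial[OF ne]])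
    show "((\<lambda>r. 1 / r\<^sup>2) has_real_derivative - (2 / r ^ 3)) (at (norm (x - y)))"
      using rr by (auto intro!: derivative_eq_intros simp: r_def eval_nat_numeral field_simps)
  qed (use r in \<open>simp add: r_def eval_nat_numeral mult_ac\<close>)
  define K where "K = m * (s - d\<^sup>2) / 2 - C"
  have dK: "((\<lambda>x. m * ((norm (x - p))\<^sup>2 - d\<^sup>2) / 2 - C) has_derivative (\<lambda>h. m * ((x - p) \<bullet> h))) (at x)"
    by (rule has_derivative_eq_rhs, (rule derivative_intros has_derivative_norm_diff_square)+) auto
  have did: "((\<lambda>x. x - q) has_derivative (\<lambda>h. h)) (at x)" for q
    by (auto intro!: derivative_eq_intros)
  define A where "A = K * (1 / r\<^sup>2) + 1 + m * \<rho> * (1 / r)"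
  \<comment> \<open>\<open>a\<close> and \<open>b\<close> are the gradients of the scalar factors
    \<open>1 - E\<close> and \<open>E * A\<close>, so \<open>L\<close> consists of two rank-one maps
    and two multiples of the identity, whose traces are read off separately.\<close>
  define a where "a = (m * E / r\<^sup>2) *\<^sub>R (x - y)"
  define b where "b = (E * (- (m * A / r\<^sup>2) - 2 * K / r ^ 4 - m * \<rho> / r ^ 3)) *\<^sub>R (x - y)
      + (E * m / r\<^sup>2) *\<^sub>R (x - p)"
  define L where "L = (\<lambda>h. (a \<bullet> h) *\<^sub>R (x - p) + (1 - E) *\<^sub>R h + (b \<bullet> h) *\<^sub>R (x - y) + (E * A) *\<^sub>R h)"
  have bg: "barrier_grad \<rho> d C m p y = (\<lambda>x. (1 - (\<rho> / norm (x - y)) ^ m) *\<^sub>R (x - p)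
     + ((\<rho> / norm (x - y)) ^ m * ((m * ((norm (x - p))\<^sup>2 - d\<^sup>2) / 2 - C) * (1 / (norm (x - y))\<^sup>2)
          + 1 + m * \<rho> * (1 / norm (x - y)))) *\<^sub>R (x - y))"
    by (simp add: barrier_grad_def fun_eq_iff)
  note dA = has_derivative_add[OF has_derivative_add[OF has_derivative_mult[OF dK dJ]
        has_derivative_const[of 1]] has_derivative_mult_right[OF dI, of "m * \<rho>"]]
  have "(barrier_grad \<rho> d C m p y has_derivative L) (at x)"
    unfolding bg
  proof (rule has_derivative_eq_rhs[OF has_derivative_add[OF
        has_derivative_scaleR[OF has_derivative_diff[OF has_derivative_const dE] did]
        has_derivative_scaleR[OF has_derivative_mult[OF dE dA] did]]],
        unfold r_def[symmetric] E_def[symmetric] s_def[symmetric], unfold K_def[symmetric],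
        unfold A_def[symmetric], rule ext)
    fix h
    have 1: "0 - - (m * E / r) / r * ((x - y) \<bullet> h) = a \<bullet> h"
      by (simp add: a_def power2_eq_square)
    have 2: "E * (K * (- (2 / r ^ 4) * ((x - y) \<bullet> h)) + m * ((x - p) \<bullet> h) * (1 / r\<^sup>2) + 0 +
          m * \<rho> * (- (1 / r ^ 3) * ((x - y) \<bullet> h))) + - (m * E / r) / r * ((x - y) \<bullet> h) * A = b \<bullet> h"
      using r unfolding b_def inner_add_left inner_scaleR_left
      by (simp add: field_simps eval_nat_numeral)
    show "(1 - E) *\<^sub>R h + (0 - - (m * E / r) / r * ((x - y) \<bullet> h)) *\<^sub>R (x - p) +
       ((E * A) *\<^sub>R h + (E * (K * (- (2 / r ^ 4) * ((x - y) \<bullet> h)) + m * ((x - p) \<bullet> h) * (1 / r\<^sup>2) + 0 +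
          m * \<rho> * (- (1 / r ^ 3) * ((x - y) \<bullet> h))) + - (m * E / r) / r * ((x - y) \<bullet> h) * A) *\<^sub>R (x - y)) = L h"
      unfolding 1 2 by (simp add: L_def)
  qed
  moreover have "(\<Sum>i\<in>UNIV. L (axis i 1) $ i) = a \<bullet> (x - p) + b \<bullet> (x - y) + (m + 2) * (1 - E + E * A)"
  proof -
    have "(\<Sum>i\<in>UNIV. (c *\<^sub>R axis i (1::real) :: real^'n) $ i) = (m + 2) * c" for c :: real
      using assms(4) by (simp add: algebra_simps)
    then show ?thesis
      unfolding L_def vector_add_component sum.distrib trace_rank_one by (simp add: algebra_simps)
  qed
  moreover have "a \<bullet> (x - p) + b \<bullet> (x - y) + (m + 2) * (1 - E + E * A) \<ge> m + 2"
  proof -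
    define q where "q = (x - y) \<bullet> (x - p)"
    have xy: "(x - y) \<bullet> (x - y) = r\<^sup>2" by (simp add: r_def dot_square_norm)
    \<comment> \<open>Since \<open>p\<close> lies on the sphere of radius \<open>\<rho>\<close>
      about \<open>y\<close>, the law of cosines expresses \<open>q\<close> through \<open>r\<close>
      and \<open>s\<close>.\<close>
    have "(norm (p - y))\<^sup>2 = (norm ((x - y) - (x - p)))\<^sup>2" by simp
    also have "\<dots> = r\<^sup>2 - 2 * q + s"
      by (simp add: q_def r_def s_def power2_norm_eq_inner inner_diff_left inner_diff_right inner_commute)
    finally have q: "q = (r\<^sup>2 + s - \<rho>\<^sup>2) / 2" using assms(3) by simp
    have aq: "a \<bullet> (x - p) = m * E / r\<^sup>2 * q" by (simp add: a_def q_def)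
    have bq: "b \<bullet> (x - y) = E * (- (m * A) - 2 * K / r\<^sup>2 - m * \<rho> / r) + E * m / r\<^sup>2 * q"
      using r unfolding b_def inner_add_left inner_scaleR_left xy q_def inner_commute[of "x - p"]
      by (simp add: field_simps eval_nat_numeral)
    have "a \<bullet> (x - p) + b \<bullet> (x - y) + (m + 2) * (1 - E + E * A) - (m + 2)
       = E * m * (2 * q / r\<^sup>2 + \<rho> / r - 1)"
      using r unfolding aq bq A_def by (simp add: field_simps power2_eq_square)
    also have "2 * q / r\<^sup>2 + \<rho> / r - 1 = (s + \<rho> * (r - \<rho>)) / r\<^sup>2"
      using r by (simp add: q field_simps power2_eq_square)
    also have "E * m * \<dots> \<ge> 0"
      using E0 r \<open>\<rho> > 0\<close> by (intro mult_nonneg_nonneg divide_nonneg_nonneg add_nonneg_nonneg) (auto simp: s_def)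
    finally show ?thesis by simp
  qed
  ultimately show ?thesis using assms(4) by (intro exI[of _ L]) auto
qed

subsection \<open>The gradient bounds\<close>

theorem theorem3p10:
  fixes \<Omega> :: "(real^'n) set" and u :: "real^'n \<Rightarrow> real" and Du :: "real^'n \<Rightarrow> real^'n"
    and ri re :: real
  assumes "CARD('n) \<ge> 2"
    and "open \<Omega>" and "connected \<Omega>" and "bounded \<Omega>" and "\<Omega> \<noteq> {}"
    and "interior_sphere_cond \<Omega> ri" and "exterior_sphere_cond \<Omega> re"
    and "C1_closure_grad \<Omega> u Du" and "C2_grad \<Omega> Du"
    and "\<forall>x\<in>\<Omega>. laplacian_grad Du x = real CARD('n)"
    and "\<forall>p\<in>frontier \<Omega>. u p = 0"
  shows "\<forall>p\<in>frontier \<Omega>. ri \<le> norm (Du p) \<and>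
           norm (Du p) \<le> (if CARD('n) = 2 then 3/2 else real CARD('n) / 2)
              * (diameter \<Omega> * (diameter \<Omega> + re) / re)"
proof
  fix p assume p: "p \<in> frontier \<Omega>"
  note op = \<open>open \<Omega>\<close> and bd = \<open>bounded \<Omega>\<close> and C1 = \<open>C1_closure_grad \<Omega> u Du\<close>
  define m where "m = CARD('n) - 2"
  have N: "CARD('n) = m + 2" using assms(1) by (simp add: m_def)
  define d where "d = diameter \<Omega>"
  have "d \<ge> 0" using bd by (simp add: d_def diameter_ge_0)
  have "ri > 0" "re > 0"
    using assms(6,7) by (auto simp: interior_sphere_cond_def exterior_sphere_cond_def)
  have fr: "frontier \<Omega> = closure \<Omega> - \<Omega>" using op by (simp add: frontier_def interior_open)
  have pcl: "p \<in> closure \<Omega>" and up: "u p = 0" using p fr assms(11) by auto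
  obtain x0 where x0: "ball x0 ri \<subseteq> \<Omega>" "cball x0 ri \<inter> frontier \<Omega> = {p}"
    using assms(6) p by (auto simp: interior_sphere_cond_def)
  obtain y where y: "ball y re \<subseteq> - closure \<Omega>" "cball y re \<inter> frontier \<Omega> = {p}"
    using assms(7) p by (auto simp: exterior_sphere_cond_def)
  have dx0: "dist x0 p = ri" by (rule touching_ball_dist_eq[OF x0(2)]) (use x0(1) fr in blast)
  have dy: "dist y p = re" by (rule touching_ball_dist_eq[OF y(2)]) (use y(1) fr in blast)
  have lap_u: "\<exists>L. (Du has_derivative L) (at x) \<and> (\<Sum>i\<in>UNIV. L (axis i 1) $ i) = real CARD('n)"
    if "x \<in> \<Omega>" for x
    using that assms(9,10) unfolding C2_grad_def laplacian_grad_def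
    by (intro exI[of _ "frechet_derivative Du (at x)"]) (auto simp: frechet_derivative_works)

  \<comment> \<open>\<open>u\<close> is subharmonic, so it is compared with the zero
    function.\<close>
  have u_le: "u x \<le> 0" if "x \<in> closure \<Omega>" for x
  proof (rule comparison_principle[OF op bd C1, of "\<lambda>_. 0" "\<lambda>_. 0" 0])
    show "C1_closure_grad \<Omega> (\<lambda>_. 0) (\<lambda>_. 0)"
      by (simp add: C1_closure_grad_def)
    show "\<exists>L. (Du has_derivative L) (at x) \<and> (\<Sum>i\<in>UNIV. L (axis i 1) $ i) \<ge> 0" if "x \<in> \<Omega>" for x
      using lap_u[OF that] by force
    show "\<exists>L. ((\<lambda>_. 0::real^'n) has_derivative L) (at x) \<and> (\<Sum>i\<in>UNIV. L (axis i 1) $ i) \<le> 0" for x :: "real^'n"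
      by (intro exI[of _ "\<lambda>_. 0"]) simp
  qed (use that assms(11) in auto)

  \<comment> \<open>The inward normal at \<open>p\<close>, of length \<open>ri\<close>.\<close>
  define e where "e = x0 - p"
  have ne: "norm e = ri" using dx0 by (simp add: e_def dist_norm)
  have ee: "e \<bullet> e = ri\<^sup>2" by (simp add: dot_square_norm ne)
  then have e_pos: "e \<bullet> (x0 - p) > 0" using \<open>ri > 0\<close> by (simp add: e_def[symmetric])
  from interior_ball_inward_ray[OF dx0 this]
  obtain \<delta> where \<delta>: "\<delta> > 0" "\<And>t. 0 < t \<Longrightarrow> t < \<delta> \<Longrightarrow> p + t *\<^sub>R e \<in> ball x0 ri"
    by blast

  \<comment> \<open>\<open>u\<close> vanishes at \<open>p\<close> and is nonpositive on every ray
    entering the interior ball, so \<open>Du p\<close> is in the polar of a half-space and its norm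
    is controlled by the slope along \<open>e\<close>.\<close>
  have normal: "norm (Du p) * ri \<le> - (Du p \<bullet> e)"
  proof -
    have "norm (Du p) * norm e \<le> - (Du p \<bullet> e)"
    proof (rule norm_mult_le_neg_inner_if_dual_cone)
      fix h assume "h \<bullet> e > 0"
      then have "h \<bullet> (x0 - p) > 0" by (simp add: e_def)
      from interior_ball_inward_ray[OF dx0 this]
      obtain \<delta> where \<delta>: "\<delta> > 0" "\<And>t. 0 < t \<Longrightarrow> t < \<delta> \<Longrightarrow> p + t *\<^sub>R h \<in> ball x0 ri"
        by blast
      show "Du p \<bullet> h \<le> 0"
        by (rule inner_le_zero_of_nonpos_along_ray[OF C1 pcl up \<delta>(1)])
          (use \<delta>(2) x0(1) u_le closure_subset in blast)
    qed
    then show ?thesis by (simp add: ne)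
  qed

  \<comment> \<open>The lower bound: comparison inside the interior ball\<close>
  have lower: "ri \<le> norm (Du p)"
  proof -
    \<comment> \<open>The torsion function of the interior ball: its Laplacian is \<open>N\<close>,
      and on the sphere it vanishes while \<open>u \<le> 0\<close>.\<close>
    define w where "w = (\<lambda>x. ((norm (x - x0))\<^sup>2 - ri\<^sup>2) / 2)"
    have C1w: "C1_closure_grad \<Omega> w (\<lambda>x. x - x0)"
      unfolding C1_closure_grad_def
    proof (intro conjI ballI)
      show "(w has_derivative (\<lambda>h. (x - x0) \<bullet> h)) (at x)" for x
        unfolding w_def
        by (rule has_derivative_eq_rhs, (rule derivative_intros has_derivative_norm_diff_square)+) auto
    qed (auto simp: w_def intro!: continuous_intros)
    have clB: "closure (ball x0 ri) \<subseteq> closure \<Omega>" by (rule closure_mono[OF x0(1)])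
    have u_le_w: "u x \<le> w x" if "x \<in> ball x0 ri" for x
    proof (rule comparison_principle[of "ball x0 ri" u Du w "\<lambda>x. x - x0" "real CARD('n)"])
      show "\<exists>L. (Du has_derivative L) (at x) \<and> (\<Sum>i\<in>UNIV. L (axis i 1) $ i) \<ge> real CARD('n)"
        if "x \<in> ball x0 ri" for x
        using lap_u[of x] that x0(1) by force
      show "\<exists>L. ((\<lambda>x. x - x0) has_derivative L) (at x) \<and> (\<Sum>i\<in>UNIV. L (axis i 1) $ i) \<le> real CARD('n)" for x
        by (intro exI[of _ "\<lambda>h. h"]) (auto intro!: derivative_eq_intros)
      show "u x \<le> w x" if "x \<in> frontier (ball x0 ri)" for x
      proof -
        have "norm (x - x0) = ri" using that \<open>ri > 0\<close>
          by (simp add: frontier_ball dist_norm norm_minus_commute)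
        then show ?thesis using u_le[of x] clB that by (auto simp: w_def frontier_def)
      qed
      show "x \<in> closure (ball x0 ri)" using that closure_subset by blast
    qed (use C1_closure_grad_subset[OF C1 x0(1)] C1_closure_grad_subset[OF C1w x0(1)] in auto)
    \<comment> \<open>\<open>u - w\<close> vanishes at \<open>p\<close> and is nonpositive towards
      the centre; the gradient of \<open>w\<close> at \<open>p\<close> is
      \<open>- e\<close>.\<close>
    have "(Du p - (p - x0)) \<bullet> e \<le> 0"
    proof (rule inner_le_zero_of_nonpos_along_ray[OF C1_closure_grad_diff[OF C1 C1w] pcl _ \<delta>(1)])
      show "u p - w p = 0" using up dx0 by (simp add: w_def dist_norm norm_minus_commute)
      show "p + t *\<^sub>R e \<in> \<Omega> \<and> u (p + t *\<^sub>R e) - w (p + t *\<^sub>R e) \<le> 0" if "0 < t" "t < \<delta>" for t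
        using \<delta>(2)[OF that] x0(1) u_le_w by force
    qed
    moreover have "p - x0 = - e" by (simp add: e_def)
    ultimately have "ri\<^sup>2 \<le> - (Du p \<bullet> e)" by (simp add: inner_add_left ee)
    also have "\<dots> \<le> norm (Du p) * ri"
      using Cauchy_Schwarz_ineq2[of "Du p" e] by (simp add: ne)
    finally show ?thesis using \<open>ri > 0\<close> by (simp add: power2_eq_square)
  qed

  \<comment> \<open>The upper bound: comparison with the barrier on all of
    \<open>\<Omega>\<close>\<close>
  have r_ge: "norm (x - y) \<ge> re" if "x \<in> closure \<Omega>" for x
    using y(1) that by (force simp: dist_norm norm_minus_commute)
  have py: "norm (p - y) = re" using dy by (simp add: dist_norm norm_minus_commute)
  have xp: "norm (x - p) \<le> d" if "x \<in> closure \<Omega>" for x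
    using diameter_bounded_bound[OF bounded_closure[OF bd] that pcl] bd
    by (simp add: d_def diameter_closure dist_norm)
  define C where "C = re\<^sup>2 * (1 + m) + re * d * (1 + m / 2) + d\<^sup>2 / 3"
  obtain \<psi> where \<psi>: "\<And>r. r > 0 \<Longrightarrow> (\<psi> has_real_derivative (re / r) ^ m * (r + m * re - C / r)) (at r)"
    "\<psi> re = 0"
  proof (rule antiderivative_on_pos_reals[of "\<lambda>r. (re / r) ^ m * (r + m * re - C / r)" re])
    show "isCont (\<lambda>r. (re / r) ^ m * (r + m * re - C / r)) r" if "r > 0" for r
      using that by (auto intro!: continuous_intros)
  qed auto
  define w where "w = (\<lambda>x. ((norm (x - p))\<^sup>2 - d\<^sup>2) / 2 * (1 - (re / norm (x - y)) ^ m) + \<psi> (norm (x - y)))"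
  define Dw where "Dw = barrier_grad re d C m p y"
  have xy: "x \<noteq> y" if "x \<in> closure \<Omega>" for x using r_ge[OF that] \<open>re > 0\<close> by auto
  have dw: "(w has_derivative (\<lambda>h. Dw x \<bullet> h)) (at x)" if "x \<in> closure \<Omega>" for x
    unfolding w_def Dw_def by (rule barrier_has_gradient[OF xy[OF that] \<psi>(1)])
  have lap_w: "\<exists>L. (Dw has_derivative L) (at x) \<and> (\<Sum>i\<in>UNIV. L (axis i 1) $ i) \<ge> real CARD('n)"
    if "x \<in> closure \<Omega>" for x
    unfolding Dw_def by (rule barrier_laplacian_ge[OF \<open>re > 0\<close> r_ge[OF that] py N])
  have C1w: "C1_closure_grad \<Omega> w Dw"
    unfolding C1_closure_grad_def
  proof (intro conjI ballI continuous_at_imp_continuous_on)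
    show "isCont w x" if "x \<in> closure \<Omega>" for x using dw[OF that] by (rule has_derivative_continuous)
    show "isCont Dw x" if "x \<in> closure \<Omega>" for x using lap_w[OF that] has_derivative_continuous by blast
    show "(w has_derivative (\<lambda>h. Dw x \<bullet> h)) (at x)" if "x \<in> \<Omega>" for x
      using dw that closure_subset by blast
  qed
  \<comment> \<open>Both summands are nonpositive: the distance to \<open>p\<close> is at most
    \<open>d\<close>, and the distance to \<open>y\<close> lies between \<open>re\<close> and
    \<open>re + d\<close>, the range in which \<open>\<psi> \<le> 0\<close>.\<close>
  have w_le: "w x \<le> 0" if "x \<in> closure \<Omega>" for x
  proof -
    have "norm (x - y) \<le> norm (x - p) + norm (p - y)" using norm_triangle_ineq[of "x - p" "p - y"] by simp
    then have "norm (x - y) \<le> re + d" using xp[OF that] py by simp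
    then have "\<psi> (norm (x - y)) \<le> 0"
      using radial_correction_nonpos[OF \<open>re > 0\<close> \<open>d \<ge> 0\<close> C_def \<psi> r_ge[OF that]] by blast
    moreover have "(norm (x - p))\<^sup>2 \<le> d\<^sup>2" using xp[OF that] by (simp add: power_mono)
    moreover have "(re / norm (x - y)) ^ m \<le> 1"
      using r_ge[OF that] \<open>re > 0\<close> by (intro power_le_one) (auto simp: divide_le_eq_1)
    ultimately show ?thesis unfolding w_def
      by (intro add_nonpos_nonpos mult_nonpos_nonneg) auto
  qed
  have w_le_u: "w x \<le> u x" if "x \<in> closure \<Omega>" for x
  proof (rule comparison_principle[OF op bd C1w C1 _ _ _ that])
    show "\<exists>L. (Dw has_derivative L) (at x) \<and> (\<Sum>i\<in>UNIV. L (axis i 1) $ i) \<ge> real CARD('n)" if "x \<in> \<Omega>" for x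
      using lap_w that closure_subset by blast
    show "\<exists>L. (Du has_derivative L) (at x) \<and> (\<Sum>i\<in>UNIV. L (axis i 1) $ i) \<le> real CARD('n)" if "x \<in> \<Omega>" for x
      using lap_u[OF that] by force
    show "w x \<le> u x" if "x \<in> frontier \<Omega>" for x
      using w_le[of x] that assms(11) fr by auto
  qed
  \<comment> \<open>The length of \<open>Dw p\<close>. At \<open>p\<close> the factor
    \<open>(re / r) ^ m\<close> equals 1, so the \<open>x - p\<close> term vanishes and a multiple
    of \<open>p - y\<close>, a vector of length \<open>re\<close>, remains.\<close>
  define c where "c = m * d\<^sup>2 / (2 * re) + d * (1 + m / 2) + d\<^sup>2 / (3 * re)"
  have "c \<ge> 0" using \<open>d \<ge> 0\<close> \<open>re > 0\<close> by (simp add: c_def)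
  have "(m * (0 - d\<^sup>2) / 2 - C) / re\<^sup>2 + 1 + m * re / re = - c / re"
    using \<open>re > 0\<close> by (simp add: C_def c_def field_simps power2_eq_square)
  then have Dwp: "Dw p = (- c / re) *\<^sub>R (p - y)"
    using \<open>re > 0\<close> by (simp add: Dw_def barrier_grad_def py)
  have "(Dw p - Du p) \<bullet> e \<le> 0"
  proof (rule inner_le_zero_of_nonpos_along_ray[OF C1_closure_grad_diff[OF C1w C1] pcl _ \<delta>(1)])
    show "w p - u p = 0" using up py \<psi>(2) \<open>re > 0\<close> by (simp add: w_def)
    fix t assume "0 < t" "t < \<delta>"
    then have "p + t *\<^sub>R e \<in> \<Omega>" using \<delta>(2) x0(1) by blast
    then show "p + t *\<^sub>R e \<in> \<Omega> \<and> w (p + t *\<^sub>R e) - u (p + t *\<^sub>R e) \<le> 0"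
      using w_le_u[of "p + t *\<^sub>R e"] closure_subset[of \<Omega>] by auto
  qed
  then have "norm (Du p) * ri \<le> - (Dw p \<bullet> e)" using normal by (simp add: inner_diff_left)
  also have "\<dots> \<le> norm (Dw p) * norm e" using Cauchy_Schwarz_ineq2[of "Dw p" e] by simp
  also have "\<dots> = c * ri" using \<open>re > 0\<close> \<open>c \<ge> 0\<close> by (simp add: Dwp py ne)
  finally have "norm (Du p) \<le> c" using \<open>ri > 0\<close> by simp
  \<comment> \<open>The terms linear in \<open>d\<close> agree exactly; the quadratic ones leave a
    surplus of \<open>2 / 3 * d\<^sup>2 / re\<close>.\<close>
  also have "c \<le> real CARD('n) / 2 * (d * (d + re) / re)"
  proof -
    have "real CARD('n) / 2 * (d * (d + re) / re) - c = 2 / 3 * d\<^sup>2 / re"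
      using \<open>re > 0\<close> by (simp add: N c_def field_simps power2_eq_square)
    also have "\<dots> \<ge> 0" using \<open>re > 0\<close> by simp
    finally show ?thesis by simp
  qed
  \<comment> \<open>For \<open>N = 2\<close> the factor obtained is 1, below the claimed
    3/2.\<close>
  also have "\<dots> \<le> (if CARD('n) = 2 then 3/2 else real CARD('n) / 2) * (d * (d + re) / re)"
    using \<open>d \<ge> 0\<close> \<open>re > 0\<close> by (intro mult_right_mono) auto
  finally show "ri \<le> norm (Du p) \<and> norm (Du p) \<le> (if CARD('n) = 2 then 3/2 else real CARD('n) / 2)
              * (diameter \<Omega> * (diameter \<Omega> + re) / re)"
    using lower by (simp add: d_def)
qed

end
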